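(* Let $\lambda=(\lambda_1,\lambda_2)$ and $\mu=(\mu_1,\mu_2)$ be partitions such that $\lambda/\mu$ is a horizontal strip of length $\ell$, i.e. $\mu_2\le\lambda_2\le\mu_1\le\lambda_1$ and $\lambda_1-\mu_1+\lambda_2-\mu_2=\ell$. Let $m=\mu_1-\mu_2$ and $j=\lambda_2-\mu_2$. Then $$\frac{(q;q)_\ell}{(t;q)_\ell}\,\varphi_{\lambda/\mu}=c_j^{(\ell)}(q^m).$$
   Context: Fix $q,t\in\mathbb{C}^\times$ such that the only pair of integers $(a,b)$ with $q^at^b=1$ is $(0,0)$. Let $(z;q)_j=(1-z)(1-zq)\cdots(1-zq^{j-1})$ with $(z;q)_0=1$, $(z;q)_\infty=(1-z)(1-zq)(1-zq^2)\cdots$, and for $0\le j\le\ell$ $$\genfrac[]{0pt}{0}{\ell}{j}_{q,t}=\frac{(q;q)_\ell/(t;q)_\ell}{\big((q;q)_j/(t;q)_j\big)\big((q;q)_{\ell-j}/(t;q)_{\ell-j}\big)},\qquad c_j^{(\ell)}(q^m)=\genfrac[]{0pt}{0}{\ell}{j}_{q,t}\frac{(q^mq^{-(j-1)};q)_j}{(tq^mq^{-j};q)_j}\cdot\frac{(t^2q^mq^{\ell-2j};q)_j}{(tq^mq^{\ell-2j+1};q)_j}.$$ A partition $(\lambda_1,\lambda_2)$ has integers $\lambda_1\ge\lambda_2\ge0$; $\ell(\lambda)$ is the number of nonzero parts, and parts with index larger than $2$ are $0$. Following Macdonald, $$\varphi_{\lambda/\mu}=\prod_{1\le i\le k\le\ell(\lambda)}\frac{f(q^{\lambda_i-\lambda_k}t^{k-i})}{f(q^{\lambda_i-\mu_k}t^{k-i})}\cdot\frac{f(q^{\mu_i-\mu_{k+1}}t^{k-i})}{f(q^{\mu_i-\lambda_{k+1}}t^{k-i})},\qquad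 f(u)=\frac{(tu;q)_\infty}{(qu;q)_\infty}.$$ Here each quotient $f(q^au)/f(q^bu)$ with $a,b\in\mathbb{Z}$ is understood as the finite product obtained by cancellation (which is its actual value when $|q|<1$): for $a\ge b$ it is $(q^{b+1}u;q)_{a-b}/(tq^bu;q)_{a-b}$, and for $a\le b$ it is $(tq^au;q)_{b-a}/(q^{a+1}u;q)_{b-a}$. *)

theory Defs
  imports Complex_Main
begin

definition qpoch :: "complex \<Rightarrow> complex \<Rightarrow> nat \<Rightarrow> complex" where
  "qpoch z q n = (\<Prod>i<n. 1 - z * q ^ i)"

(* Intended for j \<le> l only, where the subtraction on nat is exact. *)
definition qt_binom :: "complex \<Rightarrow> complex \<Rightarrow> nat \<Rightarrow> nat \<Rightarrow> complex" where
  "qt_binom q t l j =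
     (qpoch q q l / qpoch t q l) /
     ((qpoch q q j / qpoch t q j) * (qpoch q q (l - j) / qpoch t q (l - j)))"

(* c_j^(l)(x); the paper evaluates it at x = q^m. *)
definition c_coeff :: "complex \<Rightarrow> complex \<Rightarrow> nat \<Rightarrow> nat \<Rightarrow> complex \<Rightarrow> complex" where
  "c_coeff q t l j x =
     qt_binom q t l j *
     (qpoch (x * q powi (- (int j - 1))) q j / qpoch (t * x * q powi (- int j)) q j) *
     (qpoch (t\<^sup>2 * x * q powi (int l - 2 * int j)) q j /
      qpoch (t * x * q powi (int l - 2 * int j + 1)) q j)"

(* f_quot q t a b u stands for f(q^a u) / f(q^b u), where
   f(u) = (tu;q)_\<infinity> / (qu;q)_\<infinity>.  The infinite products are cancelled to a
   finite one, so that no condition |q| < 1 is needed. *)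
definition f_quot :: "complex \<Rightarrow> complex \<Rightarrow> int \<Rightarrow> int \<Rightarrow> complex \<Rightarrow> complex" where
  "f_quot q t a b u =
     (if b \<le> a
      then qpoch (q powi (b + 1) * u) q (nat (a - b)) / qpoch (t * q powi b * u) q (nat (a - b))
      else qpoch (t * q powi a * u) q (nat (b - a)) / qpoch (q powi (a + 1) * u) q (nat (b - a)))"

(* A partition is given by its sequence of parts, indexed from 1 and
   eventually 0; the value at index 0 is never used. *)
definition two_parts :: "nat \<Rightarrow> nat \<Rightarrow> nat \<Rightarrow> nat" where
  "two_parts a b i = (if i = 1 then a else if i = 2 then b else 0)"

definition num_parts :: "(nat \<Rightarrow> nat) \<Rightarrow> nat" where
  "num_parts lam = card {i. 1 \<le> i \<and> lam i \<noteq> 0}"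

definition phi :: "complex \<Rightarrow> complex \<Rightarrow> (nat \<Rightarrow> nat) \<Rightarrow> (nat \<Rightarrow> nat) \<Rightarrow> complex" where
  "phi q t lam mu =
     (\<Prod>k = 1..num_parts lam. \<Prod>i = 1..k.
        f_quot q t (int (lam i) - int (lam k)) (int (lam i) - int (mu k)) (t ^ (k - i)) *
        f_quot q t (int (mu i) - int (mu (k + 1))) (int (mu i) - int (lam (k + 1))) (t ^ (k - i)))"

end

theory Submission
  imports Defs
begin

text \<open>
  Write \<open>a = \<lambda>\<^sub>1 - \<mu>\<^sub>1\<close>, so that \<open>a + j = \<ell>\<close>. For two rows the pairs
  \<open>(i, k)\<close> in Macdonald's product are \<open>(1, 1)\<close>, \<open>(1, 2)\<close> and \<open>(2, 2)\<close>. The quotients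
  involving a third part of \<open>\<lambda>\<close> and \<open>\<mu>\<close> have the form \<open>f(u)/f(u) = 1\<close>, and what remains is
  \[ \frac{f(1)}{f(q^a)} \cdot \frac{f(1)}{f(q^j)} \cdot \frac{f(q^m)}{f(q^{m-j})}
     \cdot \frac{f(q^{m+a-j}t)}{f(q^{m+a}t)}. \]
  After cancellation the first two quotients are \<open>(t;q)\<^sub>a/(q;q)\<^sub>a\<close> and \<open>(t;q)\<^sub>j/(q;q)\<^sub>j\<close>;
  multiplied by \<open>(q;q)\<^sub>\<ell>/(t;q)\<^sub>\<ell>\<close> they give the binomial coefficient. The last two have
  length \<open>j\<close> and are exactly the other two factors of \<open>c\<^sub>j\<close>, because \<open>\<ell> - 2j = a - j\<close>.

  The number of rows in the product is \<open>\<ell>(\<lambda>)\<close>, which may be less than \<open>2\<close>. A row \<open>k\<close>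
  that is empty in \<open>\<lambda>\<close> is also empty in \<open>\<mu>\<close>, so the factors for the pairs \<open>(i, k)\<close> are all
  \<open>1\<close>, and the product may always be taken over two rows (lemma \<open>phi_two_rows\<close>).
\<close>

lemma f_quot_same [simp]: "f_quot q t a a u = 1"
  by (simp add: f_quot_def qpoch_def)

lemma f_quot_add_right:
  "f_quot q t a (a + int n) u =
     qpoch (t * q powi a * u) q n / qpoch (q powi (a + 1) * u) q n"
  by (cases "n = 0") (simp_all add: f_quot_def qpoch_def)

lemma f_quot_diff_right:
  "f_quot q t a (a - int n) u =
     qpoch (q powi (a - int n + 1) * u) q n / qpoch (t * q powi (a - int n) * u) q n"
  by (simp add: f_quot_def)

lemma num_parts_two_parts:
  assumes "b \<le> a"
  shows "num_parts (two_parts a b) = (if a = 0 then 0 else if b = 0 then 1 else 2)"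
proof -
  have "{i. 1 \<le> i \<and> two_parts a b i \<noteq> 0} =
          (if a = 0 then {} else if b = 0 then {1} else {1, 2})"
    using assms by (auto simp: two_parts_def)
  then show ?thesis
    by (simp add: num_parts_def)
qed

text \<open>
  Containment makes the formula uniform in the length of \<open>\<lambda>\<close>: \<open>\<lambda>\<^sub>2 = 0\<close> forces \<open>\<mu>\<^sub>2 = 0\<close>,
  so that the last two quotients on the right, those with \<open>k = 2\<close>, compare equal exponents;
  if \<open>\<lambda>\<^sub>1 = 0\<close>, then all four do.
\<close>
lemma phi_two_rows:
  assumes "lam2 \<le> lam1" "mu1 \<le> lam1" "mu2 \<le> lam2"
  shows "phi q t (two_parts lam1 lam2) (two_parts mu1 mu2) =
    f_quot q t 0 (int lam1 - int mu1) 1 *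
    f_quot q t (int mu1 - int mu2) (int mu1 - int lam2) 1 *
    f_quot q t (int lam1 - int lam2) (int lam1 - int mu2) t *
    f_quot q t 0 (int lam2 - int mu2) 1"
proof -
  show ?thesis
    unfolding phi_def num_parts_two_parts[OF assms(1)]
    using assms by (auto simp: numeral_2_eq_2 two_parts_def)
qed

theorem proposition2p1:
  fixes q t :: complex
    and lam1 lam2 mu1 mu2 l m j :: nat
  assumes "q \<noteq> 0" and "t \<noteq> 0"
    and generic: "\<And>a b :: int. q powi a * t powi b = 1 \<Longrightarrow> a = 0 \<and> b = 0"
    and "lam2 \<le> lam1" and "mu2 \<le> mu1"
    and "mu2 \<le> lam2" and "lam2 \<le> mu1" and "mu1 \<le> lam1"
    and "int lam1 - int mu1 + int lam2 - int mu2 = int l"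
    and "int m = int mu1 - int mu2"
    and "int j = int lam2 - int mu2"
  shows "qpoch q q l / qpoch t q l * phi q t (two_parts lam1 lam2) (two_parts mu1 mu2)
           = c_coeff q t l j (q ^ m)"
proof -
  define a where "a = lam1 - mu1"
  have a: "int lam1 - int mu1 = int a"
    using \<open>mu1 \<le> lam1\<close> by (simp add: a_def)
  have l: "l = a + j"
    using assms(9,11) a by linarith
  have exps: "int mu1 - int lam2 = int m - int j"
    "int lam1 - int lam2 = int m + int a - int j"
    "int lam1 - int mu2 = (int m + int a - int j) + int j"
    using assms(10,11) a by linarith+
  have phi: "phi q t (two_parts lam1 lam2) (two_parts mu1 mu2) =
      (qpoch t q a / qpoch q q a) *
      (qpoch (q powi (int m - int j + 1)) q j / qpoch (t * q powi (int m - int j)) q j) *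
      (qpoch (t\<^sup>2 * q powi (int m + int a - int j)) q j /
       qpoch (t * q powi (int m + int a - int j + 1)) q j) *
      (qpoch t q j / qpoch q q j)"
    unfolding phi_two_rows[OF assms(4,8,6)] a exps assms(10)[symmetric] assms(11)[symmetric]
    unfolding f_quot_add_right f_quot_diff_right
    using f_quot_add_right[of q t 0 a 1] f_quot_add_right[of q t 0 j 1]
    by (simp add: power2_eq_square mult_ac)
  have shift: "q ^ m * q powi n = q powi (int m + n)" for n
    using \<open>q \<noteq> 0\<close> by (simp add: power_int_add)
  have c: "c_coeff q t l j (q ^ m) =
      qt_binom q t l j *
      (qpoch (q powi (int m - int j + 1)) q j / qpoch (t * q powi (int m - int j)) q j) *
      (qpoch (t\<^sup>2 * q powi (int m + int a - int j)) q j /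
       qpoch (t * q powi (int m + int a - int j + 1)) q j)"
    unfolding c_coeff_def mult.assoc shift by (simp add: l algebra_simps)
  show ?thesis
    unfolding phi c qt_binom_def by (simp add: l mult_ac)
qed

end
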